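(* Let $p$ be a prime. The pairing $\langle\cdot,\cdot\rangle$ on $C(\mathbb{Z}_p,\mathbb{C}_p)$ defined by $$\langle\phi,\psi\rangle = \int_{\mathbb{Z}_p}\phi\,d\mu(H_\psi)$$ is a non-degenerate symmetric $\mathbb{C}_p$-bilinear form.
   Context: $C(\mathbb{Z}_p,\mathbb{C}_p)$ is the $\mathbb{C}_p$-vector space of continuous functions $\mathbb{Z}_p \to \mathbb{C}_p$. For $n\ge0$, $\beta_n(x) = \binom{x}{n}$; every $\phi \in C(\mathbb{Z}_p,\mathbb{C}_p)$ is uniquely $\sum_{n\ge0}a_n\beta_n$ with $a_n \in \mathbb{C}_p$, $a_n\to0$ (Mahler coefficients). A measure is a bounded linear functional $\mu : C(\mathbb{Z}_p,\mathbb{C}_p)\to\mathbb{C}_p$, and $\int_{\mathbb{Z}_p}\phi\,d\mu$ means $\mu(\phi)$. A power series $G(t) = \sum_{n\ge0}b_nt^n \in \mathbb{C}_p[[t]]$ with bounded coefficients defines a measure $\mu(G)$ by $\int_{\mathbb{Z}_p}\phi\,d\mu(G) = \sum_{n\ge0}a_nb_n$, where $(a_n)$ are the Mahler coefficients of $\phi$. For $\psi \in C(\mathbb{Z}_p,\mathbb{C}_p)$, $H_\psi(t) = \sum_{n\ge0}(-1)^n\psi(-1-n)t^n$. *)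

theory Defs
  imports "HOL-Analysis.Analysis" "HOL-Computational_Algebra.Formal_Power_Series"
begin

text \<open>Fields of characteristic 0, complete with respect to a multiplicative ultrametric
  absolute value. The topology is the library one, induced by \<open>dist x y = absv (x - y)\<close>.\<close>

class complete_ultrametric_field = field_char_0 + complete_space +
  fixes absv :: "'a \<Rightarrow> real"
  assumes dist_absv: "dist x y = absv (x - y)"
    and absv_mult: "absv (x * y) = absv x * absv y"
    and absv_ultrametric: "absv (x + y) \<le> max (absv x) (absv y)"

lemma continuous_on_ultrametric_add:
  fixes f g :: "'a::topological_space \<Rightarrow> 'k::complete_ultrametric_field"
  assumes "continuous_on S f" "continuous_on S g"
  shows "continuous_on S (\<lambda>x. f x + g x)"
  unfolding continuous_on_def
proof (intro ballI tendstoI)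
  fix x and e :: real
  assume "x \<in> S" "0 < e"
  then have "\<forall>\<^sub>F y in at x within S. dist (f y) (f x) < e"
    "\<forall>\<^sub>F y in at x within S. dist (g y) (g x) < e"
    using assms unfolding continuous_on_def by (auto intro: tendstoD)
  then show "\<forall>\<^sub>F y in at x within S. dist (f y + g y) (f x + g x) < e"
  proof eventually_elim
    case (elim y)
    have "dist (f y + g y) (f x + g x) = absv ((f y - f x) + (g y - g x))"
      by (simp add: dist_absv algebra_simps)
    also have "\<dots> \<le> max (absv (f y - f x)) (absv (g y - g x))"
      by (rule absv_ultrametric)
    finally show ?case using elim by (simp add: dist_absv)
  qed
qed

lemma continuous_on_ultrametric_cmult:
  fixes f :: "'a::topological_space \<Rightarrow> 'k::complete_ultrametric_field"
  assumes "continuous_on S f"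
  shows "continuous_on S (\<lambda>x. c * f x)"
  unfolding continuous_on_def
proof (intro ballI tendstoI)
  fix x and e :: real
  assume x: "x \<in> S" and e: "0 < e"
  have nonneg: "0 \<le> absv c"
    using zero_le_dist[of c 0] by (simp add: dist_absv)
  then have "0 < e / (absv c + 1)"
    using e by simp
  then have "\<forall>\<^sub>F y in at x within S. dist (f y) (f x) < e / (absv c + 1)"
    using assms x unfolding continuous_on_def by (auto intro: tendstoD)
  then show "\<forall>\<^sub>F y in at x within S. dist (c * f y) (c * f x) < e"
  proof eventually_elim
    case (elim y)
    have "dist (c * f y) (c * f x) = absv c * dist (f y) (f x)"
      by (simp add: dist_absv flip: absv_mult right_diff_distrib)
    also have "\<dots> \<le> (absv c + 1) * dist (f y) (f x)"
      by (rule mult_right_mono) auto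
    also have "\<dots> < e"
      using elim nonneg by (simp add: field_simps)
    finally show ?case .
  qed
qed

section \<open>The field of p-adic complex numbers\<close>

text \<open>In a complete ultrametric field with \<open>absv p = 1/p\<close>, \<open>absv\<close> restricts to the
  p-adic absolute value on the rationals, so the closure of the rationals is the
  completion \<open>\<rat>\<^sub>p\<close>; its unit ball is \<open>\<int>\<^sub>p\<close>.\<close>

definition Q_p :: "'k::complete_ultrametric_field set"
  where "Q_p = closure \<rat>"

definition Z_p :: "'k::complete_ultrametric_field set"
  where "Z_p = {x \<in> Q_p. absv x \<le> 1}"

definition Q_p_bar :: "'k::complete_ultrametric_field set"
  where "Q_p_bar = {x. \<exists>q. q \<noteq> 0 \<and> (\<forall>i. coeff q i \<in> Q_p) \<and> poly q x = 0}"

text \<open>For a prime \<open>p\<close>: \<open>'k\<close> is \<open>\<complex>\<^sub>p\<close>, the completion of the algebraic closure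
  \<open>Q_p_bar\<close> of \<open>\<rat>\<^sub>p\<close>, normalised by \<open>absv p = 1/p\<close>. Completeness is part of the class.
  These conditions determine \<open>'k\<close> up to isometric isomorphism.\<close>

definition is_C_p :: "nat \<Rightarrow> 'k::complete_ultrametric_field itself \<Rightarrow> bool"
  where "is_C_p p _ \<longleftrightarrow>
    absv (of_nat p :: 'k) = 1 / real p \<and>
    (\<forall>q :: 'k poly. (\<forall>i. coeff q i \<in> Q_p_bar) \<and> degree q > 0 \<longrightarrow>
        (\<exists>x \<in> Q_p_bar. poly q x = 0)) \<and>
    closure (Q_p_bar :: 'k set) = UNIV"

section \<open>Continuous functions on the p-adic integers\<close>

text \<open>\<open>C(\<int>\<^sub>p, \<complex>\<^sub>p)\<close>. A function on \<open>Z_p\<close> is represented by its extension by 0 to all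
  of \<open>'k\<close>, so that equality is equality on \<open>Z_p\<close>.\<close>

typedef (overloaded) 'k zp_fun =
  "{f :: 'k::complete_ultrametric_field \<Rightarrow> 'k. continuous_on Z_p f \<and> (\<forall>x. x \<notin> Z_p \<longrightarrow> f x = 0)}"
  morphisms zp_apply Abs_zp_fun
  by (rule exI[of _ "\<lambda>_. 0"]) auto

setup_lifting type_definition_zp_fun

instantiation zp_fun :: (complete_ultrametric_field) ab_group_add
begin

lift_definition zero_zp_fun :: "'a zp_fun" is "\<lambda>_. 0"
  by auto

lift_definition plus_zp_fun :: "'a zp_fun \<Rightarrow> 'a zp_fun \<Rightarrow> 'a zp_fun" is "\<lambda>f g x. f x + g x"
  by (auto intro: continuous_on_ultrametric_add)

lift_definition uminus_zp_fun :: "'a zp_fun \<Rightarrow> 'a zp_fun" is "\<lambda>f x. - f x"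
  using continuous_on_ultrametric_cmult[of _ _ "-1"] by auto

definition minus_zp_fun :: "'a zp_fun \<Rightarrow> 'a zp_fun \<Rightarrow> 'a zp_fun"
  where "minus_zp_fun f g = f + - g"

instance
  by standard (auto simp: minus_zp_fun_def, (transfer; force simp: algebra_simps)+)

end

lift_definition zp_scale :: "'k::complete_ultrametric_field \<Rightarrow> 'k zp_fun \<Rightarrow> 'k zp_fun"
  is "\<lambda>c f x. c * f x"
  by (auto intro: continuous_on_ultrametric_cmult)

lemma vector_space_zp_scale: "vector_space (zp_scale :: 'k::complete_ultrametric_field \<Rightarrow> _)"
  by standard (transfer; force simp: algebra_simps)+

lemma vector_space_times: "vector_space ((*) :: 'k::field \<Rightarrow> 'k \<Rightarrow> 'k)"
  by standard (auto simp: algebra_simps)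

definition zp_sup_norm :: "'k::complete_ultrametric_field zp_fun \<Rightarrow> real"
  where "zp_sup_norm \<phi> = (SUP x\<in>Z_p. absv (zp_apply \<phi> x))"

section \<open>Mahler coefficients, measures and the pairing\<close>

text \<open>The series \<open>\<Sum>n. a n * (x gchoose n)\<close> converges to \<open>\<phi>\<close> in \<open>C(\<int>\<^sub>p, \<complex>\<^sub>p)\<close>, that is,
  uniformly on \<open>Z_p\<close>. By Mahler's theorem there is a unique such sequence.\<close>

definition mahler_coeff :: "'k::complete_ultrametric_field zp_fun \<Rightarrow> nat \<Rightarrow> 'k"
  where "mahler_coeff \<phi> = (THE a. a \<longlonglongrightarrow> 0 \<and>
    uniform_limit Z_p (\<lambda>N x. \<Sum>n<N. a n * (x gchoose n)) (zp_apply \<phi>) sequentially)"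

typedef (overloaded) 'k zp_measure =
  "{\<mu> :: 'k::complete_ultrametric_field zp_fun \<Rightarrow> 'k.
      Vector_Spaces.linear zp_scale (*) \<mu> \<and> (\<exists>B. \<forall>\<phi>. absv (\<mu> \<phi>) \<le> B * zp_sup_norm \<phi>)}"
  morphisms zp_integral Abs_zp_measure
proof -
  have "absv (0 :: 'k) = 0"
    using dist_absv[of "0::'k" 0] by simp
  moreover have "Vector_Spaces.linear zp_scale (*) (\<lambda>_ :: 'k zp_fun. 0 :: 'k)"
    by (simp add: Vector_Spaces.linear_iff vector_space_zp_scale vector_space_times)
  ultimately show ?thesis
    by (intro exI[of _ "\<lambda>_. 0"]) (auto intro!: exI[of _ 0])
qed

text \<open>The measure \<open>\<mu>(G)\<close>; only meaningful when \<open>G\<close> has bounded coefficients.\<close>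

definition fps_measure :: "'k::complete_ultrametric_field fps \<Rightarrow> 'k zp_measure"
  where "fps_measure G = Abs_zp_measure (\<lambda>\<phi>. \<Sum>n. mahler_coeff \<phi> n * fps_nth G n)"

definition H_series :: "'k::complete_ultrametric_field zp_fun \<Rightarrow> 'k fps"
  where "H_series \<psi> = Abs_fps (\<lambda>n. (-1) ^ n * zp_apply \<psi> (-1 - of_nat n))"

definition zp_pairing ::
    "'k::complete_ultrametric_field zp_fun \<Rightarrow> 'k zp_fun \<Rightarrow> 'k"
  where "zp_pairing \<phi> \<psi> = zp_integral (fps_measure (H_series \<psi>)) \<phi>"

section \<open>Forms on a vector space\<close>

definition bilinear_form :: "('k::field \<Rightarrow> 'v::ab_group_add \<Rightarrow> 'v) \<Rightarrow> ('v \<Rightarrow> 'v \<Rightarrow> 'k) \<Rightarrow> bool"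
  where "bilinear_form s B \<longleftrightarrow>
    (\<forall>w. Vector_Spaces.linear s (*) (\<lambda>v. B v w)) \<and>
    (\<forall>v. Vector_Spaces.linear s (*) (\<lambda>w. B v w))"

definition symmetric_form :: "('v \<Rightarrow> 'v \<Rightarrow> 'k) \<Rightarrow> bool"
  where "symmetric_form B \<longleftrightarrow> (\<forall>v w. B v w = B w v)"

definition nondegenerate_form :: "('v::zero \<Rightarrow> 'v \<Rightarrow> 'k::zero) \<Rightarrow> bool"
  where "nondegenerate_form B \<longleftrightarrow>
    (\<forall>v. (\<forall>w. B v w = 0) \<longrightarrow> v = 0) \<and> (\<forall>w. (\<forall>v. B v w = 0) \<longrightarrow> w = 0)"

end

theory Submission
  imports Defs "HOL-Number_Theory.Cong"
begin

text \<open>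
  Write \<open>a\<close> and \<open>b\<close> for the Mahler coefficients of \<open>\<phi>\<close> and \<open>\<psi>\<close>. Unfolding the definitions gives
  \<open>\<langle>\<phi>, \<psi>\<rangle> = (\<Sum>m. a m * (-1)^m * \<psi> (-1-m))\<close>. Expanding \<open>\<psi> (-1-m)\<close> in its Mahler series and using
  \<open>(-1)^m * binom (-1-m) n = (-1)^(m+n) * binom (m+n) n\<close> turns the pairing into the double series
  \<open>\<Sum>m n. a m * b n * (-1)^(m+n) * binom (m+n) n\<close>, whose kernel is symmetric in \<open>m\<close> and \<open>n\<close>.
  To avoid exchanging infinite sums, the pairing is obtained as the limit of the square
  truncations of this series (\<open>truncated_pairing_tendsto\<close>): the error of replacing \<open>\<psi> (-1-m)\<close> by a
  partial Mahler sum is uniform in \<open>m\<close>. Linearity in \<open>\<phi>\<close> is built into measures, so symmetry gives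
  bilinearity. If \<open>\<psi>\<close> pairs to 0 with every binomial function, then \<open>\<psi>\<close> vanishes at all \<open>-1-m\<close>,
  which are dense in the p-adic integers, so \<open>\<psi> = 0\<close>.

  All of this rests on Mahler's theorem, without which the coefficients, being given by a definite
  description, would carry no information. Evaluating an expansion at natural numbers is Newton's
  forward difference formula, so the only candidates are the iterated differences at 0. That these
  tend to 0 is the substance of the theorem: if \<open>f\<close> is bounded by \<open>M\<close> and changes by at most \<open>M/p\<close>
  under translation by \<open>p^s\<close>, then its difference of order \<open>p^s\<close> is bounded by \<open>M/p\<close>, because \<open>p\<close>
  divides the inner binomial coefficients (\<open>absv_forward_diff_prime_power_le\<close>). Such an \<open>s\<close> exists by
  uniform continuity, and the step can be iterated since differences inherit uniform
  continuity. Finally, an estimate for all p-adic integers follows from the same estimate at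
  natural numbers by density (\<open>absv_le_of_dense\<close>), so Newton's formula bounds the remainders
  uniformly.
\<close>

section \<open>Ultrametric absolute values\<close>

lemma absv_nonneg [simp]: "0 \<le> absv (x :: 'k::complete_ultrametric_field)"
  using zero_le_dist[of x 0] by (simp add: dist_absv)

lemma absv_eq_0_iff [simp]: "absv (x :: 'k::complete_ultrametric_field) = 0 \<longleftrightarrow> x = 0"
  using dist_eq_0_iff[of x 0] by (simp add: dist_absv)

lemma absv_0 [simp]: "absv (0 :: 'k::complete_ultrametric_field) = 0"
  by simp

lemma absv_1 [simp]: "absv (1 :: 'k::complete_ultrametric_field) = 1"
proof -
  have "absv (1 :: 'k) * absv (1 :: 'k) = absv (1 :: 'k)" "absv (1 :: 'k) \<noteq> 0"
    by (simp_all flip: absv_mult)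
  then show ?thesis by (metis mult_cancel_left1)
qed

lemma absv_minus [simp]: "absv (- x :: 'k::complete_ultrametric_field) = absv x"
  using dist_commute[of x 0] by (simp add: dist_absv)

lemma absv_minus_commute: "absv (x - y :: 'k::complete_ultrametric_field) = absv (y - x)"
  using absv_minus[of "x - y"] by simp

lemma absv_add_le:
  fixes x y :: "'k::complete_ultrametric_field"
  assumes "absv x \<le> B" "absv y \<le> B"
  shows "absv (x + y) \<le> B"
  using absv_ultrametric[of x y] assms by simp

lemma absv_diff_le:
  fixes x y :: "'k::complete_ultrametric_field"
  assumes "absv x \<le> B" "absv y \<le> B"
  shows "absv (x - y) \<le> B"
  using absv_add_le[of x B "- y"] assms by simp

lemma absv_power: "absv (x ^ n :: 'k::complete_ultrametric_field) = absv x ^ n"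
  by (induction n) (simp_all add: absv_mult)

lemma absv_minus_one_power [simp]: "absv ((-1) ^ n :: 'k::complete_ultrametric_field) = 1"
  by (simp add: absv_power)

lemma absv_sum_le:
  fixes f :: "'a \<Rightarrow> 'k::complete_ultrametric_field"
  assumes "\<And>i. i \<in> A \<Longrightarrow> absv (f i) \<le> B" "0 \<le> B"
  shows "absv (sum f A) \<le> B"
  using assms by (induction A rule: infinite_finite_induct) (auto intro: absv_add_le)

lemma absv_mult_le:
  fixes x y :: "'k::complete_ultrametric_field"
  assumes "absv x \<le> A" "absv y \<le> B"
  shows "absv (x * y) \<le> A * B"
  unfolding absv_mult using assms by (intro mult_mono order_trans[OF absv_nonneg]) auto

lemma absv_of_nat_le_1: "absv (of_nat n :: 'k::complete_ultrametric_field) \<le> 1"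
  by (induction n) (auto intro: absv_add_le)

lemma absv_of_int_le_1: "absv (of_int z :: 'k::complete_ultrametric_field) \<le> 1"
  by (cases z) (auto simp: absv_of_nat_le_1 simp del: of_nat_Suc)

text \<open>Addition and multiplication are continuous; stating this as class inclusions makes the general
  theory of limits, continuity and series of topological groups and monoids apply to these
  fields, which are not real normed spaces.\<close>

instance complete_ultrametric_field \<subseteq> topological_ab_group_add
proof
  fix a b :: 'a
  show "LIM x (nhds a \<times>\<^sub>F nhds b). fst x + snd x :> nhds (a + b)"
  proof (rule tendstoI)
    fix e :: real assume e: "e > 0"
    have "\<forall>\<^sub>F x in nhds a \<times>\<^sub>F nhds b. dist (fst x) a < e \<and> dist (snd x) b < e"
      using e by (intro eventually_prodI) (auto simp: eventually_nhds_metric)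
    then show "\<forall>\<^sub>F x in nhds a \<times>\<^sub>F nhds b. dist (fst x + snd x) (a + b) < e"
    proof eventually_elim
      case (elim x)
      have "dist (fst x + snd x) (a + b) = absv ((fst x - a) + (snd x - b))"
        by (simp add: dist_absv algebra_simps)
      also have "\<dots> \<le> max (absv (fst x - a)) (absv (snd x - b))"
        by (rule absv_ultrametric)
      also have "\<dots> < e"
        using elim by (simp add: dist_absv)
      finally show ?case .
    qed
  qed
  show "(uminus \<longlongrightarrow> - a) (nhds a)"
  proof (rule tendstoI)
    fix e :: real assume "e > 0"
    moreover have "dist (- x) (- a) = dist x a" for x :: 'a
      by (simp add: dist_absv absv_minus_commute)
    ultimately show "\<forall>\<^sub>F x in nhds a. dist (- x) (- a) < e"
      by (auto simp: eventually_nhds_metric)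
  qed
qed

instance complete_ultrametric_field \<subseteq> topological_comm_monoid_mult
proof
  fix a b :: 'a
  show "LIM x (nhds a \<times>\<^sub>F nhds b). fst x * snd x :> nhds (a * b)"
  proof (rule tendstoI)
    fix e :: real assume e: "e > 0"
    \<comment> \<open>With \<open>u\<close>, \<open>v\<close> the errors in the two factors, \<open>a v\<close>, \<open>u b\<close> and \<open>u v\<close> must all be below \<open>e\<close>;
      \<open>d \<le> 1\<close> takes care of the last.\<close>
    define d where "d = min 1 (e / (absv a + absv b + 1))"
    have d: "d > 0" "d \<le> 1" "d * (absv a + absv b + 1) \<le> e"
      using e by (auto simp: d_def min_def field_simps add_pos_nonneg intro: add_nonneg_pos)
    have "\<forall>\<^sub>F x in nhds a \<times>\<^sub>F nhds b. dist (fst x) a < d \<and> dist (snd x) b < d"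
      using d(1) by (intro eventually_prodI) (auto simp: eventually_nhds_metric)
    then show "\<forall>\<^sub>F x in nhds a \<times>\<^sub>F nhds b. dist (fst x * snd x) (a * b) < e"
    proof eventually_elim
      case (elim x)
      define u v where "u = fst x - a" and "v = snd x - b"
      have uv: "absv u < d" "absv v < d" using elim by (auto simp: u_def v_def dist_absv)
      have "absv u * absv v \<le> 1 * absv v"
        using uv d by (intro mult_right_mono) auto
      moreover have "absv a * absv v \<le> absv a * d" "absv u * absv b \<le> d * absv b"
        using uv by (auto intro: mult_left_mono mult_right_mono)
      moreover have "absv a * d \<ge> 0" "d * absv b \<ge> 0" using d by auto
      moreover have "absv a * d + d * absv b + d \<le> e" using d(3) by (simp add: algebra_simps)
      ultimately have *: "max (max (absv a * absv v) (absv u * absv b)) (absv u * absv v) < e"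
        unfolding max_less_iff_conj using uv(2) d(1) by (intro conjI) linarith+
      have "dist (fst x * snd x) (a * b) = absv ((a * v + u * b) + u * v)"
        by (simp add: dist_absv u_def v_def algebra_simps)
      also have "\<dots> \<le> max (max (absv (a * v)) (absv (u * b))) (absv (u * v))"
        by (rule order_trans[OF absv_ultrametric max.mono[OF absv_ultrametric order_refl]])
      also have "\<dots> < e" using * by (simp add: absv_mult)
      finally show ?case .
    qed
  qed
qed

lemma tendsto_absv_bound:
  fixes f :: "'a \<Rightarrow> 'k::complete_ultrametric_field"
  assumes "(f \<longlongrightarrow> l) F" "F \<noteq> bot" "\<forall>\<^sub>F x in F. absv (f x) \<le> B"
  shows "absv l \<le> B"
proof -
  have "((\<lambda>x. absv (f x)) \<longlongrightarrow> absv l) F"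
    using tendsto_dist[OF assms(1) tendsto_const[of 0]] by (simp add: dist_absv)
  then show ?thesis
    by (rule tendsto_upperbound[OF _ assms(3,2)])
qed

text \<open>By the ultrametric inequality a block of terms is no larger than its largest term, so terms
  tending to 0 already make the partial sums Cauchy.\<close>

lemma summable_ultrametric:
  fixes f :: "nat \<Rightarrow> 'k::complete_ultrametric_field"
  assumes "f \<longlonglongrightarrow> 0"
  shows "summable f"
  unfolding summable_iff_convergent
proof (intro Cauchy_convergent metric_CauchyI)
  fix e :: real assume e: "e > 0"
  then obtain N where N: "\<And>n. n \<ge> N \<Longrightarrow> absv (f n) < e / 2"
    using assms half_gt_zero[OF e] unfolding lim_sequentially dist_absv by (metis diff_zero)
  have tail: "absv (sum f {..<n} - sum f {..<m}) < e" if "N \<le> m" "m \<le> n" for m n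
  proof -
    have "sum f {..<n} - sum f {..<m} = sum f {m..<n}"
      using that sum_diff_nat_ivl[of 0 m n f] by (simp add: atLeast0LessThan)
    also have "absv \<dots> \<le> e / 2"
      using that N e by (intro absv_sum_le) (auto intro: less_imp_le)
    finally show ?thesis using e by simp
  qed
  show "\<exists>M. \<forall>m\<ge>M. \<forall>n\<ge>M. dist (sum f {..<m}) (sum f {..<n}) < e"
    using tail by (intro exI[of _ N]) (metis absv_minus_commute dist_absv nle_le)
qed

lemma sums_cmult_ultrametric:
  fixes f :: "nat \<Rightarrow> 'k::complete_ultrametric_field"
  assumes "f sums s"
  shows "(\<lambda>n. c * f n) sums (c * s)"
  using tendsto_mult_left[OF assms[unfolded sums_def], of c] by (simp add: sums_def sum_distrib_left)

lemma tendsto_zero_mult_bounded: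
  fixes f g :: "nat \<Rightarrow> 'k::complete_ultrametric_field"
  assumes "f \<longlonglongrightarrow> 0" "\<And>n. absv (g n) \<le> B"
  shows "(\<lambda>n. f n * g n) \<longlonglongrightarrow> 0"
proof -
  have "(\<lambda>n. dist (f n) 0 * B) \<longlonglongrightarrow> 0"
    using tendsto_mult_right[OF assms(1)[THEN tendsto_dist_iff[THEN iffD1]], of B] by simp
  then have "(\<lambda>n. dist (f n * g n) 0) \<longlonglongrightarrow> 0"
    by (rule Lim_null_comparison[rotated])
      (auto simp: dist_absv absv_mult assms(2) intro!: always_eventually mult_left_mono)
  then show ?thesis by (subst tendsto_dist_iff)
qed

lemma continuous_on_gbinomial:
  "continuous_on S (\<lambda>x :: 'k::complete_ultrametric_field. x gchoose n)"
proof -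
  have "continuous_on S (\<lambda>x :: 'k. (\<Prod>i = 0..<n. x - of_nat i) * inverse (fact n))"
    by (intro continuous_on_mult' continuous_on_prod' continuous_on_diff continuous_on_id
        continuous_on_const)
  then show ?thesis by (simp add: gbinomial_prod_rev divide_inverse)
qed

section \<open>Forward differences\<close>

definition forward_diff :: "(nat \<Rightarrow> 'a::ab_group_add) \<Rightarrow> nat \<Rightarrow> 'a"
  where "forward_diff f n = f (Suc n) - f n"

text \<open>Pascal's rule in summed form: the common induction step for Newton's interpolation formula and
  for the explicit formula for iterated differences, which are inverse to each other.\<close>

lemma sum_binomial_Suc:
  fixes g :: "nat \<Rightarrow> 'a::comm_ring_1"
  shows "(\<Sum>i\<le>Suc n. of_nat (Suc n choose i) * g i) = (\<Sum>i\<le>n. of_nat (n choose i) * (g i + g (Suc i)))"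
proof -
  have "(\<Sum>i\<le>Suc n. of_nat (Suc n choose i) * g i) =
      g 0 + (\<Sum>i\<le>n. of_nat (n choose Suc i) * g (Suc i)) + (\<Sum>i\<le>n. of_nat (n choose i) * g (Suc i))"
    by (subst sum.atMost_Suc_shift) (simp add: algebra_simps sum.distrib)
  also have "g 0 + (\<Sum>i\<le>n. of_nat (n choose Suc i) * g (Suc i)) = (\<Sum>i\<le>Suc n. of_nat (n choose i) * g i)"
    by (subst sum.atMost_Suc_shift) simp
  also have "\<dots> = (\<Sum>i\<le>n. of_nat (n choose i) * g i)"
    by (simp add: binomial_eq_0)
  finally show ?thesis by (simp add: algebra_simps sum.distrib)
qed

lemma newton_forward_difference:
  fixes f :: "nat \<Rightarrow> 'a::comm_ring_1"
  shows "f (m + n) = (\<Sum>i\<le>n. of_nat (n choose i) * (forward_diff ^^ i) f m)"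
proof (induction n arbitrary: m)
  case (Suc n)
  have "f (m + Suc n) = (\<Sum>i\<le>n. of_nat (n choose i) * (forward_diff ^^ i) f (Suc m))"
    using Suc[of "Suc m"] by simp
  also have "\<dots> = (\<Sum>i\<le>n. of_nat (n choose i) *
      ((forward_diff ^^ i) f m + (forward_diff ^^ Suc i) f m))"
    by (intro sum.cong) (auto simp: forward_diff_def)
  also have "\<dots> = (\<Sum>i\<le>Suc n. of_nat (Suc n choose i) * (forward_diff ^^ i) f m)"
    by (rule sum_binomial_Suc[symmetric])
  finally show ?case .
qed simp

lemma forward_diff_power_eq:
  fixes f :: "nat \<Rightarrow> 'a::comm_ring_1"
  shows "(forward_diff ^^ n) f m = (\<Sum>i\<le>n. of_nat (n choose i) * ((-1) ^ (n + i) * f (m + i)))"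
proof (induction n arbitrary: f)
  case (Suc n)
  have "(forward_diff ^^ Suc n) f m =
      (\<Sum>i\<le>n. of_nat (n choose i) * ((-1) ^ (n + i) * forward_diff f (m + i)))"
    by (simp only: funpow_Suc_right o_apply Suc)
  also have "\<dots> = (\<Sum>i\<le>n. of_nat (n choose i) *
      ((-1) ^ (Suc n + i) * f (m + i) + (-1) ^ (Suc n + Suc i) * f (m + Suc i)))"
    by (intro sum.cong) (auto simp: forward_diff_def algebra_simps)
  also have "\<dots> = (\<Sum>i\<le>Suc n. of_nat (Suc n choose i) * ((-1) ^ (Suc n + i) * f (m + i)))"
    by (rule sum_binomial_Suc[symmetric])
  finally show ?case .
qed simp

lemma absv_forward_diff_power_le:
  fixes f :: "nat \<Rightarrow> 'k::complete_ultrametric_field"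
  assumes "\<And>i. absv (f i) \<le> B"
  shows "absv ((forward_diff ^^ n) f m) \<le> B"
proof (induction n arbitrary: m)
  case (Suc n)
  then show ?case by (simp add: forward_diff_def absv_diff_le)
qed (simp add: assms)

lemma forward_diff_power_diff:
  fixes f g :: "nat \<Rightarrow> 'a::comm_ring_1"
  shows "(forward_diff ^^ n) (\<lambda>i. f i - g i) m = (forward_diff ^^ n) f m - (forward_diff ^^ n) g m"
  by (simp add: forward_diff_power_eq right_diff_distrib sum_subtractf)

lemma forward_diff_power_shift:
  "(forward_diff ^^ n) (\<lambda>i. f (i + k)) m = (forward_diff ^^ n) f (m + k)"
  by (induction n arbitrary: m) (simp_all add: forward_diff_def)

section \<open>The p-adic integers\<close>

text \<open>The normalisation makes \<open>absv\<close> restrict to the p-adic absolute value on the integers. The type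
  argument fixes the field, since \<open>p\<close> alone does not determine it.\<close>

locale padic_absv =
  fixes p :: nat and K :: "'k::complete_ultrametric_field itself"
  assumes prime_p: "prime p" and absv_p: "absv (of_nat p :: 'k) = 1 / real p"
begin

lemma p_gt_1: "1 < p"
  using prime_p by (rule prime_gt_1_nat)

lemma absv_le_of_dvd:
  assumes "p ^ s dvd n"
  shows "absv (of_nat n :: 'k) \<le> 1 / real p ^ s"
proof -
  obtain m where "n = p ^ s * m" using assms ..
  moreover have "1 / real p ^ s * absv (of_nat m :: 'k) \<le> 1 / real p ^ s * 1"
    by (intro mult_left_mono absv_of_nat_le_1) auto
  ultimately show ?thesis
    by (simp add: absv_mult absv_power absv_p power_one_over)
qed

lemma absv_of_int_le_of_dvd:
  assumes "int (p ^ s) dvd z"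
  shows "absv (of_int z :: 'k) \<le> 1 / real p ^ s"
proof -
  have "p ^ s dvd nat \<bar>z\<bar>" using assms by (simp add: int_dvd_int_iff[symmetric])
  moreover have "absv (of_int z :: 'k) = absv (of_nat (nat \<bar>z\<bar>) :: 'k)"
  proof (cases "0 \<le> z")
    case False
    then have "(of_nat (nat \<bar>z\<bar>) :: 'k) = - of_int z" by simp
    then show ?thesis by (simp only: absv_minus)
  qed simp
  ultimately show ?thesis using absv_le_of_dvd by (simp only:)
qed

text \<open>From a Bezout relation \<open>u p + v z = 1\<close>: since the first term has absolute value at most \<open>1/p\<close>,
  the second one must have absolute value 1.\<close>

lemma absv_of_int_coprime:
  assumes "\<not> int p dvd z"
  shows "absv (of_int z :: 'k) = 1"
proof (rule ccontr)
  assume "absv (of_int z :: 'k) \<noteq> 1"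
  then have lt: "absv (of_int z :: 'k) < 1" using absv_of_int_le_1[of z, where 'k = 'k] by simp
  have "coprime (int p) z"
    using assms prime_p by (simp add: prime_imp_coprime)
  then obtain u v where uv: "u * int p + v * z = 1"
    using bezout_int[of "int p" z] by auto
  have "1 = absv (of_int (u * int p + v * z) :: 'k)" by (simp only: uv of_int_1 absv_1)
  also have "\<dots> \<le> max (absv (of_int u * of_int (int p) :: 'k)) (absv (of_int v * of_int z :: 'k))"
    by (simp only: of_int_add of_int_mult absv_ultrametric)
  also have "\<dots> \<le> max (1 * (1 / real p)) (1 * absv (of_int z :: 'k))"
    by (intro max.mono absv_mult_le absv_of_int_le_1) (auto simp: absv_p)
  also have "\<dots> < 1" using lt p_gt_1 by simp
  finally show False by simp
qed

lemma exists_prime_power_less: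
  assumes "0 < (e :: real)"
  obtains s where "1 / real p ^ s < e"
  using real_arch_pow_inv[OF assms, of "1 / real p"] p_gt_1 by (auto simp: power_one_over)

text \<open>A fraction \<open>a/b\<close> in lowest terms with absolute value at most 1 has \<open>b\<close> prime to \<open>p\<close>. With \<open>c\<close>
  inverse to \<open>b\<close> modulo \<open>p^s\<close>, the residue of \<open>a c\<close> approximates \<open>a/b\<close> up to \<open>p^(-s)\<close>.\<close>

lemma rat_approx_of_nat:
  assumes "r \<in> \<rat>" "absv (r :: 'k) \<le> 1" "0 < e"
  obtains n where "absv (r - of_nat n) < e"
proof -
  obtain s where s: "1 / real p ^ s < e" using exists_prime_power_less[OF assms(3)] .
  obtain a b :: int where ab: "b > 0" "coprime a b" "r = of_int a / of_int b"
    using Rats_cases'[OF assms(1)] by metis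
  have rb: "r * of_int b = of_int a" using ab by simp
  have ndvd: "\<not> int p dvd b"
  proof
    assume pb: "int p dvd b"
    have "absv (of_int a :: 'k) \<le> 1 * (1 / real p)"
      unfolding rb[symmetric] using assms(2) absv_of_int_le_of_dvd[of 1 b] pb
      by (intro absv_mult_le) auto
    then have "int p dvd a" using absv_of_int_coprime[of a] p_gt_1 by fastforce
    then have "is_unit (int p)" using pb ab(2) by (meson coprime_common_divisor)
    then show False using p_gt_1 by simp
  qed
  then have "coprime b (int (p ^ s))"
    using prime_p by (simp add: prime_imp_coprime coprime_commute[of b])
  then obtain c where c: "[b * c = 1] (mod int (p ^ s))"
    using cong_solve_coprime_int by blast
  define n where "n = nat ((a * c) mod int (p ^ s))"
  have n: "int n = (a * c) mod int (p ^ s)" using p_gt_1 by (simp add: n_def)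
  have "[b * int n = b * (a * c)] (mod int (p ^ s))"
    unfolding n by (intro cong_mult cong_refl) (simp add: cong_def)
  also have "b * (a * c) = a * (b * c)" by simp
  also have "[a * (b * c) = a * 1] (mod int (p ^ s))"
    using c by (intro cong_mult cong_refl)
  finally have "int (p ^ s) dvd a - b * int n"
    by (simp add: cong_iff_dvd_diff dvd_diff_commute)
  then have "absv (of_int (a - b * int n) :: 'k) \<le> 1 / real p ^ s"
    by (rule absv_of_int_le_of_dvd)
  also have "of_int (a - b * int n) = of_int b * (r - of_nat n)"
    using rb by (simp add: algebra_simps)
  also have "absv (of_int b * (r - of_nat n)) = absv (r - of_nat n)"
    using absv_of_int_coprime[OF ndvd] by (simp add: absv_mult)
  finally have "absv (r - of_nat n) \<le> 1 / real p ^ s" .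
  then show ?thesis using s by (intro that[of n]) linarith
qed

lemma of_nat_in_Z_p [simp]: "(of_nat n :: 'k) \<in> Z_p"
  using closure_subset[of "\<rat> :: 'k set"] by (auto simp: Z_p_def Q_p_def absv_of_nat_le_1)

lemma Z_p_approx_of_nat:
  assumes "(x :: 'k) \<in> Z_p" "0 < e"
  obtains n where "absv (x - of_nat n) < e"
proof -
  define d where "d = min e 1"
  have d: "0 < d" "d \<le> e" "d \<le> 1" using assms(2) by (auto simp: d_def)
  obtain r where r: "r \<in> \<rat>" "absv (x - r) < d"
    using assms(1) d(1) unfolding Z_p_def Q_p_def closure_approachable
    by (auto simp: dist_absv absv_minus_commute)
  have "absv x \<le> 1" using assms(1) by (simp add: Z_p_def)
  then have "absv (x - (x - r)) \<le> 1"
    using r(2) d(3) by (intro absv_diff_le[of x 1 "x - r"]) linarith+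
  then have "absv r \<le> 1" by simp
  then obtain n where n: "absv (r - of_nat n) < d"
    using rat_approx_of_nat[OF r(1) _ d(1)] by blast
  have "absv ((x - r) + (r - of_nat n)) < e"
    using absv_ultrametric[of "x - r" "r - of_nat n"] r n d by simp
  then show ?thesis using that by simp
qed

lemma closed_Z_p: "closed (Z_p :: 'k set)"
proof -
  have "Z_p = Q_p \<inter> cball (0 :: 'k) 1"
    by (auto simp: Z_p_def dist_absv)
  then show ?thesis by (metis Q_p_def closed_Int closed_cball closed_closure)
qed

lemma Z_pI:
  assumes "\<And>e. e > 0 \<Longrightarrow> \<exists>n. absv (x - of_nat n :: 'k) < e"
  shows "x \<in> Z_p"
proof -
  have "x \<in> closure Z_p"
    unfolding closure_approachable
    by (metis assms absv_minus_commute dist_absv of_nat_in_Z_p)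
  then show ?thesis using closed_Z_p by simp
qed

text \<open>If \<open>n\<close> approximates \<open>x\<close>, then \<open>-1-n\<close> approximates \<open>-1-x\<close>, and adding a multiple of a high power
  of \<open>p\<close> makes it a natural number.\<close>

lemma reflect_in_Z_p:
  assumes "(x :: 'k) \<in> Z_p"
  shows "-1 - x \<in> Z_p"
proof (rule Z_pI)
  fix e :: real assume e: "e > 0"
  obtain n where n: "absv (x - of_nat n) < e" using Z_p_approx_of_nat[OF assms e] .
  obtain s where s: "1 / real p ^ s < e" using exists_prime_power_less[OF e] .
  define N where "N = p ^ s * (n + 1)"
  have "1 * (n + 1) \<le> N" unfolding N_def using p_gt_1 by (intro mult_right_mono) simp_all
  then have "-1 - x - of_nat (N - (n + 1)) = - ((x - of_nat n) + of_nat N)"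
    by (simp add: of_nat_diff)
  moreover have "absv (of_nat N :: 'k) < e"
    using absv_le_of_dvd[of s N] s by (simp add: N_def del: of_nat_mult of_nat_add)
  then have "absv ((x - of_nat n) + of_nat N) < e"
    using absv_ultrametric[of "x - of_nat n" "of_nat N"] n by linarith
  ultimately have "absv (-1 - x - of_nat (N - (n + 1))) < e"
    by (simp only: absv_minus)
  then show "\<exists>m. absv (-1 - x - of_nat m) < e" ..
qed

text \<open>The device that transfers estimates on binomial coefficients and Mahler remainders
  from the natural numbers to all of \<open>Z_p\<close>.\<close>

lemma absv_le_of_dense:
  fixes f :: "'k \<Rightarrow> 'k"
  assumes "continuous_on Z_p f" "\<And>n. absv (f (of_nat n)) \<le> B" "x \<in> Z_p"
  shows "absv (f x) \<le> B"
proof (rule field_le_epsilon)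
  fix e :: real assume e: "e > 0"
  obtain d where d: "d > 0" "\<And>y. y \<in> Z_p \<Longrightarrow> dist y x < d \<Longrightarrow> dist (f y) (f x) < e"
    using assms(1,3) e unfolding continuous_on_iff by metis
  obtain n where "absv (x - of_nat n) < d" using Z_p_approx_of_nat[OF assms(3) d(1)] .
  then have "absv (f x - f (of_nat n)) < e"
    using d(2)[of "of_nat n"] by (simp add: dist_absv absv_minus_commute)
  then have "absv ((f x - f (of_nat n)) + f (of_nat n)) \<le> B + e"
    using assms(2)[of n] e order_trans[OF absv_nonneg assms(2)[of n]]
    by (intro absv_add_le) auto
  then show "absv (f x) \<le> B + e" by (simp only: diff_add_cancel)
qed

lemma absv_gbinomial_le_1:
  assumes "(x :: 'k) \<in> Z_p"
  shows "absv (x gchoose n) \<le> 1"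
proof (rule absv_le_of_dense[OF continuous_on_gbinomial _ assms])
  show "absv (of_nat m gchoose n :: 'k) \<le> 1" for m
    unfolding binomial_gbinomial[symmetric] by (rule absv_of_nat_le_1)
qed

text \<open>Total boundedness: the residues \<open>0, \<dots>, p^s - 1\<close> form a \<open>p^(-s)\<close>-net.\<close>

lemma compact_Z_p: "compact (Z_p :: 'k set)"
  unfolding compact_eq_totally_bounded
proof (intro conjI allI impI)
  show "complete (Z_p :: 'k set)" by (simp add: complete_eq_closed closed_Z_p)
  fix e :: real assume e: "e > 0"
  obtain s where s: "1 / real p ^ s < e" using exists_prime_power_less[OF e] .
  have "x \<in> (\<Union>y\<in>of_nat ` {..<p ^ s}. ball y e)" if x: "x \<in> Z_p" for x :: 'k
  proof -
    obtain n where n: "absv (x - of_nat n) < e" using Z_p_approx_of_nat[OF x e] .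
    have "(of_nat n :: 'k) = of_nat (p ^ s * (n div p ^ s)) + of_nat (n mod p ^ s)"
      by (simp only: mult_div_mod_eq flip: of_nat_add)
    then have "x - of_nat (n mod p ^ s) = (x - of_nat n) + of_nat (p ^ s * (n div p ^ s))"
      by simp
    also have "absv \<dots> < e"
      using absv_ultrametric[of "x - of_nat n" "of_nat (p ^ s * (n div p ^ s))"] n s
        absv_le_of_dvd[of s "p ^ s * (n div p ^ s)"] by (simp del: of_nat_mult)
    finally have "x \<in> ball (of_nat (n mod p ^ s)) e"
      by (simp add: dist_absv absv_minus_commute)
    then show ?thesis using p_gt_1 by fastforce
  qed
  then show "\<exists>k. finite k \<and> (Z_p :: 'k set) \<subseteq> (\<Union>x\<in>k. ball x e)"
    by (intro exI[of _ "of_nat ` {..<p ^ s}"]) blast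
qed

section \<open>Mahler's theorem\<close>

lemma prime_dvd_choose_prime_power:
  assumes "0 < k" "k < p ^ s"
  shows "p dvd (p ^ s choose k)"
proof (rule ccontr)
  assume "\<not> p dvd (p ^ s choose k)"
  then have "coprime (p ^ s) (p ^ s choose k)"
    using prime_p by (simp add: prime_imp_coprime)
  moreover have "k * (p ^ s choose k) = p ^ s * (p ^ s - 1 choose (k - 1))"
    using assms by (intro times_binomial_minus1_eq) auto
  ultimately have "p ^ s dvd k"
    by (metis coprime_dvd_mult_left_iff dvd_triv_left)
  then show False using assms by (auto dest: dvd_imp_le)
qed

text \<open>In the explicit formula for the difference of order \<open>p^s\<close> all inner binomial
  coefficients are divisible by \<open>p\<close>. The two outer terms are \<open>f (n + p^s)\<close> and \<open>(-1)^(p^s) * f n\<close>. For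
  odd \<open>p\<close> they combine to \<open>f (n + p^s) - f n\<close>; for \<open>p = 2\<close> the wrong sign costs \<open>2 * f n\<close>, which is
  again divisible by \<open>p\<close>.\<close>

lemma absv_forward_diff_prime_power_le:
  fixes f :: "nat \<Rightarrow> 'k"
  assumes bound: "\<And>n. absv (f n) \<le> M"
    and osc: "\<And>n. absv (f (n + p ^ s) - f n) \<le> M / real p"
  shows "absv ((forward_diff ^^ (p ^ s)) f n) \<le> M / real p"
proof -
  define N where "N = p ^ s"
  define t where "t = (\<lambda>i. of_nat (N choose i) * ((-1) ^ (N + i) * f (n + i)))"
  have N: "N > 0" using p_gt_1 by (simp add: N_def)
  have "{..N} = insert 0 (insert N {0<..<N})" using N by auto
  then have "(forward_diff ^^ N) f n = t 0 + (t N + sum t {0<..<N})"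
    using N by (simp add: forward_diff_power_eq t_def)
  also have "t 0 + (t N + sum t {0<..<N}) =
      ((f (n + N) - f n) + (1 + (-1) ^ N) * f n) + sum t {0<..<N}"
    by (simp add: t_def algebra_simps flip: mult_2 power_mult_distrib power_add)
  finally have eq: "(forward_diff ^^ N) f n =
      ((f (n + N) - f n) + (1 + (-1) ^ N) * f n) + sum t {0<..<N}" .
  have "absv (1 + (-1) ^ N :: 'k) \<le> 1 / real p"
  proof (cases "even N")
    case True
    then have "p = 2" using prime_p N_def
      by (metis even_power primes_dvd_imp_eq two_is_prime_nat)
    then show ?thesis using True absv_p by simp
  qed simp
  then have "absv ((1 + (-1) ^ N) * f n) \<le> 1 / real p * M"
    using bound by (rule absv_mult_le)
  moreover have "absv (t i) \<le> 1 / real p * (1 * M)" if "i \<in> {0<..<N}" for i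
    unfolding t_def using that absv_le_of_dvd[of 1] prime_dvd_choose_prime_power[of i s]
    by (intro absv_mult_le bound) (auto simp: N_def)
  then have "absv (sum t {0<..<N}) \<le> 1 / real p * (1 * M)"
    using order_trans[OF absv_nonneg bound] by (intro absv_sum_le) auto
  ultimately show ?thesis
    using osc[of n] eq by (auto simp: N_def[symmetric] intro!: absv_add_le)
qed

text \<open>Repeating the previous step gains a factor \<open>1/p\<close> each time, and further
  differences cannot increase the bound.\<close>

lemma forward_diff_tendsto_0:
  fixes f :: "nat \<Rightarrow> 'k"
  assumes bound: "\<And>n. absv (f n) \<le> M"
    and unif: "\<And>e. e > 0 \<Longrightarrow> \<exists>s. \<forall>n. absv (f (n + p ^ s) - f n) \<le> e"
  shows "(\<lambda>n. (forward_diff ^^ n) f 0) \<longlonglongrightarrow> 0"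
proof -
  \<comment> \<open>A strictly positive bound, so that the assumption \<open>unif\<close> applies to \<open>C / p^(j+1)\<close>.\<close>
  define C where "C = M + 1"
  have C: "C > 0" "absv (f n) \<le> C" for n
    using bound[of n] order_trans[OF absv_nonneg bound[of 0]] by (auto simp: C_def)
  have decay: "\<exists>N. \<forall>n. absv ((forward_diff ^^ N) f n) \<le> C / real p ^ j" for j
  proof (induction j)
    case 0
    show ?case using C by (intro exI[of _ 0]) simp
  next
    case (Suc j)
    then obtain N where N: "\<And>n. absv ((forward_diff ^^ N) f n) \<le> C / real p ^ j" by blast
    have "C / real p ^ j / real p > 0" using C p_gt_1 by simp
    then obtain s where s: "\<And>n. absv (f (n + p ^ s) - f n) \<le> C / real p ^ j / real p"
      using unif by blast
    have osc: "absv ((forward_diff ^^ N) f (n + p ^ s) - (forward_diff ^^ N) f n)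
        \<le> C / real p ^ j / real p" for n
      using absv_forward_diff_power_le[where f = "\<lambda>i. f (i + p ^ s) - f i" and n = N and m = n, OF s]
      by (simp add: forward_diff_power_diff forward_diff_power_shift)
    have "absv ((forward_diff ^^ (p ^ s + N)) f n) \<le> C / real p ^ Suc j" for n
      using absv_forward_diff_prime_power_le[where f = "(forward_diff ^^ N) f", OF N osc, of n]
      by (simp add: funpow_add mult.commute)
    then show ?case by blast
  qed
  show ?thesis
  proof (rule metric_LIMSEQ_I)
    fix e :: real assume e: "e > 0"
    then obtain j where "1 / real p ^ j < e / C"
      using exists_prime_power_less[of "e / C"] C by auto
    then have j: "C / real p ^ j < e" using C by (simp add: field_simps)
    obtain N where N: "\<And>n. absv ((forward_diff ^^ N) f n) \<le> C / real p ^ j"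
      using decay by blast
    have "dist ((forward_diff ^^ n) f 0) 0 < e" if "n \<ge> N" for n
    proof -
      have "(forward_diff ^^ n) f 0 = (forward_diff ^^ (n - N)) ((forward_diff ^^ N) f) 0"
        using that funpow_add[of "n - N" N "forward_diff :: (nat \<Rightarrow> 'k) \<Rightarrow> _"]
        by (simp only: le_add_diff_inverse2 o_apply)
      then show ?thesis
        using absv_forward_diff_power_le[where f = "(forward_diff ^^ N) f" and n = "n - N" and m = 0, OF N] j
        by (simp add: dist_absv)
    qed
    then show "\<exists>N. \<forall>n\<ge>N. dist ((forward_diff ^^ n) f 0) 0 < e" by blast
  qed
qed

lemma continuous_on_zp_apply: "continuous_on Z_p (zp_apply (\<phi> :: 'k zp_fun))"
  using zp_apply[of \<phi>] by simp

lemma bdd_above_absv_zp_apply: "bdd_above ((\<lambda>x. absv (zp_apply (\<phi> :: 'k zp_fun) x)) ` Z_p)"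
proof -
  have "bounded (zp_apply \<phi> ` Z_p)"
    by (intro compact_imp_bounded compact_continuous_image continuous_on_zp_apply compact_Z_p)
  then obtain B where "\<And>x. x \<in> Z_p \<Longrightarrow> dist 0 (zp_apply \<phi> x) \<le> B"
    unfolding bounded_any_center[of _ 0] by auto
  then show ?thesis by (intro bdd_aboveI[of _ B]) (auto simp: dist_absv)
qed

lemma absv_zp_apply_le:
  assumes "x \<in> Z_p"
  shows "absv (zp_apply (\<phi> :: 'k zp_fun) x) \<le> zp_sup_norm \<phi>"
  unfolding zp_sup_norm_def by (rule cSUP_upper[OF assms bdd_above_absv_zp_apply])

lemma zp_sup_norm_nonneg: "0 \<le> zp_sup_norm (\<phi> :: 'k zp_fun)"
  by (rule order_trans[OF absv_nonneg absv_zp_apply_le[OF of_nat_in_Z_p[of 0]]])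

definition newton_coeff :: "'k zp_fun \<Rightarrow> nat \<Rightarrow> 'k"
  where "newton_coeff \<phi> n = (forward_diff ^^ n) (\<lambda>i. zp_apply \<phi> (of_nat i)) 0"

lemma absv_newton_coeff_le: "absv (newton_coeff \<phi> n) \<le> zp_sup_norm \<phi>"
  unfolding newton_coeff_def by (intro absv_forward_diff_power_le absv_zp_apply_le) simp

lemma newton_coeff_tendsto_0: "newton_coeff \<phi> \<longlonglongrightarrow> 0"
  unfolding newton_coeff_def[abs_def]
proof (rule forward_diff_tendsto_0)
  show "absv (zp_apply \<phi> (of_nat n)) \<le> zp_sup_norm \<phi>" for n
    by (simp add: absv_zp_apply_le)
  fix e :: real assume e: "e > 0"
  have "uniformly_continuous_on Z_p (zp_apply \<phi>)"
    by (intro compact_uniformly_continuous continuous_on_zp_apply compact_Z_p)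
  then obtain d where d: "d > 0"
    "\<And>x y. x \<in> Z_p \<Longrightarrow> y \<in> Z_p \<Longrightarrow> dist y x < d \<Longrightarrow> dist (zp_apply \<phi> y) (zp_apply \<phi> x) < e"
    using e unfolding uniformly_continuous_on_def by metis
  obtain s where s: "1 / real p ^ s < d" using exists_prime_power_less[OF d(1)] .
  have "absv (zp_apply \<phi> (of_nat (n + p ^ s)) - zp_apply \<phi> (of_nat n)) \<le> e" for n
  proof -
    have "dist (of_nat (n + p ^ s)) (of_nat n :: 'k) = absv (of_nat (p ^ s) :: 'k)"
      by (simp add: dist_absv)
    also have "\<dots> < d" using absv_le_of_dvd[of s "p ^ s"] s by simp
    finally show ?thesis
      using d(2)[of "of_nat n" "of_nat (n + p ^ s)"] by (simp add: dist_absv del: of_nat_add)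
  qed
  then show "\<exists>s. \<forall>n. absv (zp_apply \<phi> (of_nat (n + p ^ s)) - zp_apply \<phi> (of_nat n)) \<le> e"
    by blast
qed

lemma newton_coeff_expansion:
  "zp_apply \<phi> (of_nat m) = (\<Sum>n\<le>m. newton_coeff \<phi> n * (of_nat m gchoose n))"
  using newton_forward_difference[of "\<lambda>i. zp_apply \<phi> (of_nat i)" 0 m]
  unfolding newton_coeff_def binomial_gbinomial by (simp only: add_0 mult.commute)

lemma gbinomial_sum_of_nat:
  fixes a :: "nat \<Rightarrow> 'k"
  assumes "m < N"
  shows "(\<Sum>n<N. a n * (of_nat m gchoose n)) = (\<Sum>n\<le>m. a n * (of_nat m gchoose n))"
  using assms by (intro sum.mono_neutral_right) (auto simp flip: binomial_gbinomial)

text \<open>At a natural number \<open>m\<close> the remainder is a finite sum of later terms of Newton's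
  formula, so the ultrametric inequality bounds it; density does the rest.\<close>

lemma newton_remainder_le:
  assumes small: "\<And>n. n \<ge> N \<Longrightarrow> absv (newton_coeff \<phi> n) \<le> e" and "0 \<le> e" "x \<in> Z_p"
  shows "absv (zp_apply \<phi> x - (\<Sum>n<N. newton_coeff \<phi> n * (x gchoose n))) \<le> e"
proof (rule absv_le_of_dense[OF _ _ assms(3)])
  let ?t = "\<lambda>x n. newton_coeff \<phi> n * (x gchoose n)"
  show "continuous_on Z_p (\<lambda>x. zp_apply \<phi> x - (\<Sum>n<N. ?t x n))"
    by (intro continuous_on_diff continuous_on_zp_apply continuous_on_sum continuous_on_mult'
        continuous_on_const continuous_on_gbinomial)
  fix m :: nat
  have "zp_apply \<phi> (of_nat m) = (\<Sum>n<N + Suc m. ?t (of_nat m) n)"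
    by (simp add: newton_coeff_expansion gbinomial_sum_of_nat del: add_Suc_right)
  also have "\<dots> = (\<Sum>n<N. ?t (of_nat m) n) + (\<Sum>n=N..<N + Suc m. ?t (of_nat m) n)"
    by (simp only: lessThan_atLeast0 sum.atLeastLessThan_concat[of 0 N "N + Suc m"] le_add1 le0)
  finally have "zp_apply \<phi> (of_nat m) - (\<Sum>n<N. ?t (of_nat m) n) =
      (\<Sum>n=N..<N + Suc m. ?t (of_nat m) n)"
    by simp
  also have "absv \<dots> \<le> e * 1"
    using assms(2) small
    by (intro absv_sum_le absv_mult_le absv_gbinomial_le_1) auto
  finally show "absv (zp_apply \<phi> (of_nat m) - (\<Sum>n<N. ?t (of_nat m) n)) \<le> e" by simp
qed

lemma newton_coeff_eventually_le:
  assumes "e > 0"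
  obtains N where "\<And>n. n \<ge> N \<Longrightarrow> absv (newton_coeff \<phi> n) \<le> e"
proof -
  obtain N where "\<And>n. n \<ge> N \<Longrightarrow> dist (newton_coeff \<phi> n) 0 < e"
    using newton_coeff_tendsto_0[of \<phi>] assms unfolding lim_sequentially by blast
  then show ?thesis by (intro that[of N]) (simp add: dist_absv less_imp_le)
qed

text \<open>At the natural number \<open>m\<close> the expansion stops after \<open>n = m\<close>, so its values at natural numbers
  determine the coefficients through a unitriangular system.\<close>

lemma newton_coeff_unique:
  fixes a :: "nat \<Rightarrow> 'k"
  assumes "uniform_limit Z_p (\<lambda>N x. \<Sum>n<N. a n * (x gchoose n)) (zp_apply \<phi>) sequentially"
  shows "a = newton_coeff \<phi>"
proof
  have expand: "zp_apply \<phi> (of_nat m) = (\<Sum>n\<le>m. a n * (of_nat m gchoose n))" for m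
  proof -
    have "(\<lambda>N. \<Sum>n<N. a n * (of_nat m gchoose n)) \<longlonglongrightarrow> zp_apply \<phi> (of_nat m)"
      by (rule tendsto_uniform_limitI[OF assms of_nat_in_Z_p])
    moreover have "(\<lambda>N. \<Sum>n<N. a n * (of_nat m gchoose n)) \<longlonglongrightarrow>
        (\<Sum>n\<le>m. a n * (of_nat m gchoose n))"
      by (intro tendsto_eventually eventually_sequentiallyI[of "Suc m"] gbinomial_sum_of_nat) simp
    ultimately show ?thesis by (rule LIMSEQ_unique)
  qed
  show "a m = newton_coeff \<phi> m" for m
  proof (induction m rule: less_induct)
    case (less m)
    have "(\<Sum>n\<le>m. a n * (of_nat m gchoose n)) =
        (\<Sum>n\<le>m. newton_coeff \<phi> n * (of_nat m gchoose n))"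
      by (simp only: expand[symmetric] newton_coeff_expansion)
    moreover have "(\<Sum>n<m. a n * (of_nat m gchoose n)) =
        (\<Sum>n<m. newton_coeff \<phi> n * (of_nat m gchoose n))"
      using less by (intro sum.cong) auto
    ultimately show ?case
      by (simp add: lessThan_Suc_atMost[symmetric] flip: binomial_gbinomial)
  qed
qed

text \<open>Mahler's theorem, in the form that the definite description is satisfied by exactly
  the iterated differences at 0.\<close>

theorem mahler_coeff_eq: "mahler_coeff \<phi> = newton_coeff \<phi>"
  unfolding mahler_coeff_def
proof (rule the_equality)
  have "uniform_limit Z_p (\<lambda>N x. \<Sum>n<N. newton_coeff \<phi> n * (x gchoose n)) (zp_apply \<phi>) sequentially"
  proof (rule uniform_limitI)
    fix e :: real assume "e > 0"
    then have e: "e / 2 > 0" by simp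
    obtain N where N: "\<And>n. n \<ge> N \<Longrightarrow> absv (newton_coeff \<phi> n) \<le> e / 2"
      using newton_coeff_eventually_le[OF e] by blast
    have "dist (\<Sum>n<M. newton_coeff \<phi> n * (x gchoose n)) (zp_apply \<phi> x) < e"
      if "M \<ge> N" "x \<in> Z_p" for M x
      using newton_remainder_le[of M \<phi> "e / 2" x] N that e
      by (simp add: dist_absv absv_minus_commute)
    then show "\<forall>\<^sub>F M in sequentially. \<forall>x\<in>Z_p.
        dist (\<Sum>n<M. newton_coeff \<phi> n * (x gchoose n)) (zp_apply \<phi> x) < e"
      by (intro eventually_sequentiallyI[of N]) blast
  qed
  then show "newton_coeff \<phi> \<longlonglongrightarrow> 0 \<and>
    uniform_limit Z_p (\<lambda>N x. \<Sum>n<N. newton_coeff \<phi> n * (x gchoose n)) (zp_apply \<phi>) sequentially"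
    using newton_coeff_tendsto_0 by blast
qed (use newton_coeff_unique in blast)

section \<open>The pairing\<close>

text \<open>The functional attached to a bounded \<open>G\<close> is linear and bounded, hence a measure, so the
  abstraction function of the type of measures can be inverted.\<close>

lemma zp_integral_fps_measure:
  fixes G :: "'k fps"
  assumes "\<And>n. absv (fps_nth G n) \<le> B"
  shows "(\<lambda>n. newton_coeff \<phi> n * fps_nth G n) sums zp_integral (fps_measure G) \<phi>"
proof -
  let ?\<mu> = "\<lambda>\<phi>. \<Sum>n. newton_coeff \<phi> n * fps_nth G n"
  have sm: "summable (\<lambda>n. newton_coeff \<phi> n * fps_nth G n)" for \<phi>
    using newton_coeff_tendsto_0 assms by (intro summable_ultrametric tendsto_zero_mult_bounded)
  have "Vector_Spaces.linear zp_scale (*) ?\<mu>"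
    unfolding Vector_Spaces.linear_iff
  proof (intro conjI allI vector_space_zp_scale vector_space_times)
    fix \<phi> \<psi> :: "'k zp_fun" and c :: 'k
    have add: "newton_coeff (\<phi> + \<psi>) n = newton_coeff \<phi> n + newton_coeff \<psi> n" for n
      by (simp add: newton_coeff_def forward_diff_power_eq plus_zp_fun.rep_eq
          distrib_left sum.distrib)
    have scale: "newton_coeff (zp_scale c \<phi>) n = c * newton_coeff \<phi> n" for n
      by (simp add: newton_coeff_def forward_diff_power_eq zp_scale.rep_eq
          sum_distrib_left mult.left_commute)
    show "?\<mu> (\<phi> + \<psi>) = ?\<mu> \<phi> + ?\<mu> \<psi>"
      by (simp only: add distrib_right suminf_add[OF sm sm])
    show "?\<mu> (zp_scale c \<phi>) = c * ?\<mu> \<phi>"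
      using sums_unique[OF sums_cmult_ultrametric[OF summable_sums[OF sm]], of c \<phi>]
      by (simp add: scale mult.assoc)
  qed
  moreover have "absv (?\<mu> \<phi>) \<le> B * zp_sup_norm \<phi>" for \<phi>
  proof (rule tendsto_absv_bound)
    show "(\<lambda>N. \<Sum>n<N. newton_coeff \<phi> n * fps_nth G n) \<longlonglongrightarrow> ?\<mu> \<phi>"
      using summable_sums[OF sm] by (simp add: sums_def)
    have B: "B \<ge> 0" using order_trans[OF absv_nonneg assms] .
    have "absv (newton_coeff \<phi> n * fps_nth G n) \<le> B * zp_sup_norm \<phi>" for n
      using absv_mult_le[OF absv_newton_coeff_le assms] by (simp add: mult.commute)
    then show "\<forall>\<^sub>F N in sequentially.
        absv (\<Sum>n<N. newton_coeff \<phi> n * fps_nth G n) \<le> B * zp_sup_norm \<phi>"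
      using B zp_sup_norm_nonneg by (intro always_eventually allI absv_sum_le) auto
  qed simp
  ultimately have "zp_integral (fps_measure G) = ?\<mu>"
    unfolding fps_measure_def mahler_coeff_eq by (intro Abs_zp_measure_inverse) blast
  then show ?thesis using sm by (simp add: summable_sums)
qed

lemma zp_pairing_sums:
  "(\<lambda>n. newton_coeff \<phi> n * ((-1) ^ n * zp_apply \<psi> (-1 - of_nat n))) sums
    (zp_pairing \<phi> \<psi> :: 'k)"
proof -
  have "absv (fps_nth (H_series \<psi>) n) \<le> 1 * zp_sup_norm \<psi>" for n
    unfolding H_series_def fps_nth_Abs_fps
    by (intro absv_mult_le absv_zp_apply_le reflect_in_Z_p of_nat_in_Z_p) simp
  from zp_integral_fps_measure[OF this, of \<phi>] show ?thesis
    by (simp add: zp_pairing_def H_series_def)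
qed

lemma gchoose_reflect:
  "(-1) ^ m * ((-1 - of_nat m :: 'k) gchoose n) = (-1) ^ (m + n) * of_nat (m + n choose n)"
proof -
  have "(-1 - of_nat m :: 'k) gchoose n = (-1) ^ n * (of_nat (m + n) gchoose n)"
    by (subst gbinomial_negated_upper) (simp add: add.commute)
  then show ?thesis
    unfolding binomial_gbinomial by (simp only: power_add mult.assoc)
qed

definition truncated_pairing :: "nat \<Rightarrow> 'k zp_fun \<Rightarrow> 'k zp_fun \<Rightarrow> 'k"
  where "truncated_pairing N \<phi> \<psi> = (\<Sum>m<N. \<Sum>n<N.
    newton_coeff \<phi> m * newton_coeff \<psi> n * ((-1) ^ (m + n) * of_nat (m + n choose n)))"

lemma truncated_pairing_commute: "truncated_pairing N \<phi> \<psi> = truncated_pairing N \<psi> \<phi>"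
proof -
  have "(m + n choose n) = (n + m choose m)" for m n
    using binomial_symmetric[of n "m + n"] by (simp add: add.commute)
  then show ?thesis
    unfolding truncated_pairing_def by (subst sum.swap) (simp add: add.commute mult.commute)
qed

text \<open>The difference between a partial sum of the pairing and the square truncation replaces
  \<open>\<psi> (-1-m)\<close> by a Mahler remainder of \<open>\<psi>\<close>, which is small uniformly in \<open>m\<close>.\<close>

lemma truncated_pairing_tendsto:
  "(\<lambda>N. truncated_pairing N \<phi> \<psi>) \<longlonglongrightarrow> zp_pairing \<phi> \<psi>"
proof -
  let ?S = "\<lambda>N. \<Sum>m<N. newton_coeff \<phi> m * ((-1) ^ m * zp_apply \<psi> (-1 - of_nat m))"
  let ?r = "\<lambda>N m. zp_apply \<psi> (-1 - of_nat m) -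
      (\<Sum>n<N. newton_coeff \<psi> n * ((-1 - of_nat m) gchoose n))"
  have diff: "?S N - truncated_pairing N \<phi> \<psi> =
      (\<Sum>m<N. newton_coeff \<phi> m * ((-1) ^ m * ?r N m))" for N
    unfolding truncated_pairing_def gchoose_reflect[symmetric]
    by (simp add: right_diff_distrib sum_subtractf sum_distrib_left mult_ac)
  have "(\<lambda>N. ?S N - truncated_pairing N \<phi> \<psi>) \<longlonglongrightarrow> 0"
  proof (rule metric_LIMSEQ_I)
    fix e :: real assume e: "e > 0"
    define d where "d = e / (2 * (zp_sup_norm \<phi> + 1))"
    have d: "d > 0" "zp_sup_norm \<phi> * (1 * d) < e"
      using e zp_sup_norm_nonneg[of \<phi>] by (auto simp: d_def field_simps add_nonneg_pos)
    obtain N where N: "\<And>n. n \<ge> N \<Longrightarrow> absv (newton_coeff \<psi> n) \<le> d"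
      using newton_coeff_eventually_le[OF d(1)] by blast
    have "absv (?S M - truncated_pairing M \<phi> \<psi>) \<le> zp_sup_norm \<phi> * (1 * d)" if "M \<ge> N" for M
      unfolding diff using that N d zp_sup_norm_nonneg[of \<phi>]
      by (intro absv_sum_le absv_mult_le absv_newton_coeff_le newton_remainder_le
          reflect_in_Z_p of_nat_in_Z_p) auto
    then show "\<exists>N. \<forall>M\<ge>N. dist (?S M - truncated_pairing M \<phi> \<psi>) 0 < e"
      using d(2) by (intro exI[of _ N]) (auto simp: dist_absv intro: le_less_trans)
  qed
  from tendsto_diff[OF zp_pairing_sums[of \<phi> \<psi>, unfolded sums_def] this] show ?thesis by simp
qed

lemma zp_pairing_commute: "zp_pairing \<phi> \<psi> = (zp_pairing \<psi> \<phi> :: 'k)"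
  using truncated_pairing_tendsto[of \<phi> \<psi>] truncated_pairing_tendsto[of \<psi> \<phi>]
  unfolding truncated_pairing_commute[of _ \<psi> \<phi>] by (rule LIMSEQ_unique)

lemma linear_zp_pairing_left: "Vector_Spaces.linear zp_scale (*) (\<lambda>\<phi>. zp_pairing \<phi> \<psi> :: 'k)"
  unfolding zp_pairing_def using zp_integral[of "fps_measure (H_series \<psi>)"] by simp

lift_definition zp_binomial :: "nat \<Rightarrow> 'k zp_fun" is "\<lambda>n x. if x \<in> Z_p then x gchoose n else 0"
  by (auto intro: continuous_on_eq[OF continuous_on_gbinomial])

lemma newton_coeff_zp_binomial: "newton_coeff (zp_binomial m) = (\<lambda>n. if n = m then 1 else 0)"
proof (rule newton_coeff_unique[symmetric], rule uniform_limitI)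
  fix e :: real assume e: "e > 0"
  have "(\<Sum>n<N. (if n = m then 1 else 0) * (x gchoose n)) = zp_apply (zp_binomial m) x"
    if "m < N" "x \<in> Z_p" for N and x :: 'k
    using that by (simp add: zp_binomial.rep_eq if_distrib[of "\<lambda>c. c * _"] sum.delta cong: if_cong)
  then show "\<forall>\<^sub>F N in sequentially. \<forall>x\<in>Z_p.
      dist (\<Sum>n<N. (if n = m then 1 else 0) * (x gchoose n)) (zp_apply (zp_binomial m) x) < e"
    using e by (intro eventually_sequentiallyI[of "Suc m"]) auto
qed

text \<open>Binomial functions test values at negative integers, which is what non-degeneracy needs.\<close>

lemma zp_pairing_binomial:
  "zp_pairing (zp_binomial m) \<psi> = (-1) ^ m * zp_apply \<psi> (-1 - of_nat m)"
proof -
  have "(\<lambda>n. if n = m then (-1) ^ n * zp_apply \<psi> (-1 - of_nat n) else 0) sums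
      zp_pairing (zp_binomial m) \<psi>"
    using zp_pairing_sums[of "zp_binomial m" \<psi>]
    by (simp add: newton_coeff_zp_binomial if_distrib[of "\<lambda>c. c * _"] cong: if_cong)
  then show ?thesis
    using sums_single[of m "\<lambda>n. (-1) ^ n * zp_apply \<psi> (-1 - of_nat n)"] sums_unique2 by blast
qed

lemma zp_pairing_eq_0_imp:
  assumes "\<And>\<phi>. zp_pairing \<phi> \<psi> = (0 :: 'k)"
  shows "\<psi> = 0"
proof -
  have "zp_apply \<psi> y = 0" if y: "y \<in> Z_p" for y
  proof -
    have "absv (zp_apply \<psi> (-1 - (-1 - y))) \<le> 0"
    proof (rule absv_le_of_dense[of "\<lambda>x. zp_apply \<psi> (-1 - x)"])
      show "continuous_on Z_p (\<lambda>x. zp_apply \<psi> (-1 - x))"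
        by (rule continuous_on_compose2[OF continuous_on_zp_apply])
          (auto intro!: continuous_on_diff continuous_on_const continuous_on_id reflect_in_Z_p)
      show "absv (zp_apply \<psi> (-1 - of_nat m)) \<le> 0" for m
        using zp_pairing_binomial[of m \<psi>] assms by simp
    qed (rule reflect_in_Z_p[OF y])
    then show ?thesis using antisym[OF _ absv_nonneg] by fastforce
  qed
  moreover have "zp_apply \<psi> y = 0" if "y \<notin> Z_p" for y
    using zp_apply[of \<psi>] that by simp
  ultimately show ?thesis
    by (intro zp_apply_inject[THEN iffD1] ext) (auto simp: zero_zp_fun.rep_eq)
qed

end

theorem proposition4p2:
  fixes p :: nat
  assumes "prime p"
    and "is_C_p p TYPE('k::complete_ultrametric_field)"
  shows "bilinear_form zp_scale (zp_pairing :: 'k zp_fun \<Rightarrow> 'k zp_fun \<Rightarrow> 'k)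
    \<and> symmetric_form (zp_pairing :: 'k zp_fun \<Rightarrow> 'k zp_fun \<Rightarrow> 'k)
    \<and> nondegenerate_form (zp_pairing :: 'k zp_fun \<Rightarrow> 'k zp_fun \<Rightarrow> 'k)"
proof -
  interpret padic_absv p "TYPE('k)"
    using assms by unfold_locales (simp_all add: is_C_p_def)
  have right: "(\<lambda>\<psi>. zp_pairing \<phi> \<psi>) = (\<lambda>\<psi>. zp_pairing \<psi> \<phi>)" for \<phi> :: "'k zp_fun"
    by (rule ext) (rule zp_pairing_commute)
  show ?thesis
    unfolding bilinear_form_def symmetric_form_def nondegenerate_form_def
  proof (intro conjI allI impI)
    fix \<phi> \<psi> :: "'k zp_fun"
    show "Vector_Spaces.linear zp_scale (*) (\<lambda>\<phi>. zp_pairing \<phi> \<psi> :: 'k)"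
      by (rule linear_zp_pairing_left)
    show "Vector_Spaces.linear zp_scale (*) (\<lambda>\<psi>. zp_pairing \<phi> \<psi> :: 'k)"
      by (subst right) (rule linear_zp_pairing_left)
    show "zp_pairing \<phi> \<psi> = (zp_pairing \<psi> \<phi> :: 'k)"
      by (rule zp_pairing_commute)
    show "\<psi> = 0" if "\<forall>\<phi>. zp_pairing \<phi> \<psi> = (0 :: 'k)"
      using that by (intro zp_pairing_eq_0_imp) blast
    show "\<phi> = 0" if "\<forall>\<psi>. zp_pairing \<phi> \<psi> = (0 :: 'k)"
      using that zp_pairing_commute[of _ \<phi>] by (intro zp_pairing_eq_0_imp) simp
  qed
qed

end
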